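(* The satisfiability problem for $\mathsf{MSO}$ over order-2 nested words (given an $\mathsf{MSO}$ sentence $\phi$, does some order-2 nested word $\mathcal N$ satisfy $\phi$?) and the model checking problem of 2-CPDS against $\mathsf{MSO}$ (given an $\mathsf{MSO}$ sentence $\phi$ and a 2-CPDS $\mathcal H$, does every order-2 nested word in $\mathcal L(\mathcal H)$ satisfy $\phi$?) are undecidable.
   Context: Order-2 stacks over a finite set $S$ of stack symbols are $[[u_1]\cdots[u_n]]$ with $u_i$ words over $S\times\{0,\dots,i-1\}$ (second components are collapse links); the initial stack is $[[\,]]$. The operations $\mathsf{Op}(S)$ are: $\uparrow_2$ (duplicate the top order-1 stack), $\downarrow_2$ (remove the top order-1 stack; undefined if only one), $\uparrow_1^s$ for $s\in S$ (append $(s,n-1)$ to the top stack $u_n$), $\downarrow_1$ (remove the last letter of the top stack; undefined if empty), $\Downarrow$ (collapse: if $u_n=u_n'(s,i)$, map to $[[u_1]\cdots[u_i]]$), $\mathsf{top}(s)$ (test that the last letter of $u_n$ has symbol $s$) and $\mathsf{top}(\bot)$ (test that $u_n$ is empty). A 2-CPDS is $\mathcal H=(Q,S,\Delta,q_0,F)$ with finite state set $Q$, initial state $q_0$, final states $F$, and transitions $\Delta\subseteq Q\times\Sigma\times\mathsf{Op}(S)\times Q$ over a finite alphabet $\Sigma$; runs start at $(q_0,[[\,]])$, each transition $(q,a,\mathsf{op},q')$ changes state $q$ to $q'$ and applies $\mathsf{op}$ to the stack (must be defined), and a run is accepting if it ends in $F$. An order-2 nested word (2-NW) over $\Sigma$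 is a tuple $\mathcal N=\langle w,\curvearrowright^1,\curvearrowright^2\rangle$, with $w=a_0\cdots a_n\in\Sigma^+$, obtained from a valid sequence of operations $\mathsf{op}_0\cdots\mathsf{op}_n$: $i\curvearrowright^1 j$ iff $\mathsf{op}_j=\downarrow_1$ and the symbol popped at $j$ was pushed by the $\uparrow_1$ at position $i$; $i\curvearrowright^2 j$ iff $\mathsf{op}_j\in\{\downarrow_2,\Downarrow\}$ and $i$ is the position of an $\uparrow_2$ that pushed one of the order-1 stacks removed at $j$. $\mathcal L(\mathcal H)$ is the set of 2-NWs generated by accepting runs of $\mathcal H$. $\mathsf{MSO}$ over 2-NWs is monadic second-order logic with syntax $\phi::=a(x)\mid x<y\mid x\curvearrowright^1 y\mid x\curvearrowright^2 y\mid\phi\vee\phi\mid\neg\phi\mid\exists x\,\phi\mid\exists X\,\phi\mid x\in X$ ($a\in\Sigma$), interpreted over positions of $w$ with the linear order $<$, the letter predicates and the two nesting relations. *)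

theory Defs
  imports Main "HOL-Library.Nat_Bijection"
begin

datatype recf = Z | Sc | Proj nat | Cn recf "recf list" | Pr recf recf | Mn recf

inductive eval :: "recf \<Rightarrow> nat list \<Rightarrow> nat \<Rightarrow> bool" where
  eval_Z: "eval Z xs 0"
| eval_Sc: "eval Sc (x # xs) (Suc x)"
| eval_Proj: "i < length xs \<Longrightarrow> eval (Proj i) xs (xs ! i)"
| eval_Cn: "list_all2 (\<lambda>g y. eval g xs y) gs ys \<Longrightarrow> eval f ys z \<Longrightarrow> eval (Cn f gs) xs z"
| eval_Pr0: "eval f xs y \<Longrightarrow> eval (Pr f g) (0 # xs) y"
| eval_PrS: "eval (Pr f g) (n # xs) y \<Longrightarrow> eval g (n # y # xs) z \<Longrightarrow> eval (Pr f g) (Suc n # xs) z"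
| eval_Mn: "eval f (n # xs) 0 \<Longrightarrow> (\<forall>m<n. \<exists>y. 0 < y \<and> eval f (m # xs) y) \<Longrightarrow> eval (Mn f) xs n"

definition decidable_on :: "('a \<Rightarrow> nat) \<Rightarrow> ('a \<Rightarrow> bool) \<Rightarrow> ('a \<Rightarrow> bool) \<Rightarrow> bool" where
  "decidable_on enc D P \<longleftrightarrow> (\<exists>f. \<forall>x. D x \<longrightarrow> eval f [enc x] (if P x then 1 else 0))"

datatype op2 = Push2 | Pop2 | Push1 nat | Pop1 | Collapse | TopSym nat | TopBot

text \<open>An order-2 stack is a list of order-1 stacks, the last one being the top one.
  Each order-1 stack carries the position of the push2 that created it (None for the initial one);
  each letter is (symbol, collapse link, position of the push1 that pushed it).\<close>
type_synonym letter1 = "nat \<times> nat \<times> nat"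
type_synonym stack2 = "(nat option \<times> letter1 list) list"

definition init_stack :: stack2 where "init_stack = [(None, [])]"

fun exec_step :: "nat \<Rightarrow> op2 \<Rightarrow> stack2 \<Rightarrow> stack2 option" where
  "exec_step j Push2 st = (if st = [] then None else Some (st @ [(Some j, snd (last st))]))"
| "exec_step j Pop2 st = (if length st \<ge> 2 then Some (butlast st) else None)"
| "exec_step j (Push1 s) st = (if st = [] then None else
      Some (butlast st @ [(fst (last st), snd (last st) @ [(s, length st - 1, j)])]))"
| "exec_step j Pop1 st = (if st = [] \<or> snd (last st) = [] then None else
      Some (butlast st @ [(fst (last st), butlast (snd (last st)))]))"
| "exec_step j Collapse st = (if st = [] \<or> snd (last st) = [] then None else
      (let i = fst (snd (last (snd (last st)))) in if i = 0 then None else Some (take i st)))"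
| "exec_step j (TopSym s) st = (if st = [] \<or> snd (last st) = [] then None else
      (if fst (last (snd (last st))) = s then Some st else None))"
| "exec_step j TopBot st = (if st \<noteq> [] \<and> snd (last st) = [] then Some st else None)"

fun exec_from :: "nat \<Rightarrow> op2 list \<Rightarrow> stack2 \<Rightarrow> stack2 option" where
  "exec_from j [] st = Some st"
| "exec_from j (o1 # ops) st =
     (case exec_step j o1 st of None \<Rightarrow> None | Some st' \<Rightarrow> exec_from (Suc j) ops st')"

definition valid_ops :: "op2 list \<Rightarrow> bool" where
  "valid_ops ops \<longleftrightarrow> exec_from 0 ops init_stack \<noteq> None"

definition stack_before :: "op2 list \<Rightarrow> nat \<Rightarrow> stack2 option" where
  "stack_before ops j = exec_from 0 (take j ops) init_stack"

definition nest1 :: "op2 list \<Rightarrow> nat \<Rightarrow> nat \<Rightarrow> bool" where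
  "nest1 ops i j \<longleftrightarrow> j < length ops \<and> ops ! j = Pop1 \<and>
     (\<exists>st. stack_before ops j = Some st \<and> st \<noteq> [] \<and> snd (last st) \<noteq> [] \<and>
           snd (snd (last (snd (last st)))) = i)"

definition nest2 :: "op2 list \<Rightarrow> nat \<Rightarrow> nat \<Rightarrow> bool" where
  "nest2 ops i j \<longleftrightarrow> j < length ops \<and> (ops ! j = Pop2 \<or> ops ! j = Collapse) \<and>
     (\<exists>st st'. stack_before ops j = Some st \<and> exec_step j (ops ! j) st = Some st' \<and>
           Some i \<in> fst ` set (drop (length st') st))"

type_synonym nw2 = "nat list \<times> (nat \<Rightarrow> nat \<Rightarrow> bool) \<times> (nat \<Rightarrow> nat \<Rightarrow> bool)"

definition nw_of :: "nat list \<Rightarrow> op2 list \<Rightarrow> nw2" where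
  "nw_of w ops = (w, nest1 ops, nest2 ops)"

definition is_2NW :: "nat list \<Rightarrow> nw2 \<Rightarrow> bool" where
  "is_2NW Alph N \<longleftrightarrow> (\<exists>w ops. w \<noteq> [] \<and> set w \<subseteq> set Alph \<and> length ops = length w \<and>
      valid_ops ops \<and> N = nw_of w ops)"

datatype mso = Lt nat nat | Less nat nat | Nest1 nat nat | Nest2 nat nat
  | Or mso mso | Neg mso | ExFO nat mso | ExSO nat mso | Mem nat nat

fun holds :: "nw2 \<Rightarrow> (nat \<Rightarrow> nat) \<Rightarrow> (nat \<Rightarrow> nat set) \<Rightarrow> mso \<Rightarrow> bool" where
  "holds (w, R1, R2) I J (Lt a x) = (w ! I x = a)"
| "holds (w, R1, R2) I J (Less x y) = (I x < I y)"
| "holds (w, R1, R2) I J (Nest1 x y) = R1 (I x) (I y)"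
| "holds (w, R1, R2) I J (Nest2 x y) = R2 (I x) (I y)"
| "holds N I J (Or p q) = (holds N I J p \<or> holds N I J q)"
| "holds N I J (Neg p) = (\<not> holds N I J p)"
| "holds (w, R1, R2) I J (ExFO x p) = (\<exists>v < length w. holds (w, R1, R2) (I(x := v)) J p)"
| "holds (w, R1, R2) I J (ExSO X p) = (\<exists>V \<subseteq> {..<length w}. holds (w, R1, R2) I (J(X := V)) p)"
| "holds N I J (Mem x X) = (I x \<in> J X)"

fun fv1 :: "mso \<Rightarrow> nat set" where
  "fv1 (Lt a x) = {x}" | "fv1 (Less x y) = {x, y}" | "fv1 (Nest1 x y) = {x, y}"
| "fv1 (Nest2 x y) = {x, y}" | "fv1 (Or p q) = fv1 p \<union> fv1 q" | "fv1 (Neg p) = fv1 p"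
| "fv1 (ExFO x p) = fv1 p - {x}" | "fv1 (ExSO X p) = fv1 p" | "fv1 (Mem x X) = {x}"

fun fv2 :: "mso \<Rightarrow> nat set" where
  "fv2 (Lt a x) = {}" | "fv2 (Less x y) = {}" | "fv2 (Nest1 x y) = {}"
| "fv2 (Nest2 x y) = {}" | "fv2 (Or p q) = fv2 p \<union> fv2 q" | "fv2 (Neg p) = fv2 p"
| "fv2 (ExFO x p) = fv2 p" | "fv2 (ExSO X p) = fv2 p - {X}" | "fv2 (Mem x X) = {X}"

fun letters :: "mso \<Rightarrow> nat set" where
  "letters (Lt a x) = {a}" | "letters (Or p q) = letters p \<union> letters q"
| "letters (Neg p) = letters p" | "letters (ExFO x p) = letters p"
| "letters (ExSO X p) = letters p" | "letters _ = {}"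

definition sentence :: "mso \<Rightarrow> bool" where
  "sentence \<phi> \<longleftrightarrow> fv1 \<phi> = {} \<and> fv2 \<phi> = {}"

text \<open>Truth of a sentence (assignments are irrelevant for sentences).\<close>
definition models :: "nw2 \<Rightarrow> mso \<Rightarrow> bool" where
  "models N \<phi> \<longleftrightarrow> holds N (\<lambda>_. 0) (\<lambda>_. {}) \<phi>"

text \<open>CPDS Q S Alph Delta q0 F (finite sets given as lists).\<close>
datatype cpds = CPDS "nat list" "nat list" "nat list" "(nat \<times> nat \<times> op2 \<times> nat) list" nat "nat list"

fun op_over :: "nat list \<Rightarrow> op2 \<Rightarrow> bool" where
  "op_over S (Push1 s) = (s \<in> set S)"
| "op_over S (TopSym s) = (s \<in> set S)"
| "op_over S _ = True"

fun wf_cpds :: "cpds \<Rightarrow> bool" where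
  "wf_cpds (CPDS Q S Alph Delta q0 F) \<longleftrightarrow> q0 \<in> set Q \<and> set F \<subseteq> set Q \<and>
     (\<forall>(q, a, o1, q') \<in> set Delta. q \<in> set Q \<and> a \<in> set Alph \<and> op_over S o1 \<and> q' \<in> set Q)"

fun alphabet :: "cpds \<Rightarrow> nat list" where
  "alphabet (CPDS Q S Alph Delta q0 F) = Alph"

fun lang :: "cpds \<Rightarrow> nw2 set" where
  "lang (CPDS Q S Alph Delta q0 F) =
     {nw_of (map (\<lambda>(q, a, o1, q'). a) ts) (map (\<lambda>(q, a, o1, q'). o1) ts) | ts.
        ts \<noteq> [] \<and> set ts \<subseteq> set Delta \<and>
        (\<lambda>(q, a, o1, q'). q) (hd ts) = q0 \<and>
        (\<forall>k. Suc k < length ts \<longrightarrow>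
            (\<lambda>(q, a, o1, q'). q) (ts ! Suc k) = (\<lambda>(q, a, o1, q'). q') (ts ! k)) \<and>
        (\<lambda>(q, a, o1, q'). q') (last ts) \<in> set F \<and>
        valid_ops (map (\<lambda>(q, a, o1, q'). o1) ts)}"

fun enc_op :: "op2 \<Rightarrow> nat" where
  "enc_op Push2 = prod_encode (0, 0)" | "enc_op Pop2 = prod_encode (1, 0)"
| "enc_op (Push1 s) = prod_encode (2, s)" | "enc_op Pop1 = prod_encode (3, 0)"
| "enc_op Collapse = prod_encode (4, 0)" | "enc_op (TopSym s) = prod_encode (5, s)"
| "enc_op TopBot = prod_encode (6, 0)"

fun enc_mso :: "mso \<Rightarrow> nat" where
  "enc_mso (Lt a x) = prod_encode (0, prod_encode (a, x))"
| "enc_mso (Less x y) = prod_encode (1, prod_encode (x, y))"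
| "enc_mso (Nest1 x y) = prod_encode (2, prod_encode (x, y))"
| "enc_mso (Nest2 x y) = prod_encode (3, prod_encode (x, y))"
| "enc_mso (Mem x X) = prod_encode (4, prod_encode (x, X))"
| "enc_mso (Or p q) = prod_encode (5, prod_encode (enc_mso p, enc_mso q))"
| "enc_mso (Neg p) = prod_encode (6, enc_mso p)"
| "enc_mso (ExFO x p) = prod_encode (7, prod_encode (x, enc_mso p))"
| "enc_mso (ExSO X p) = prod_encode (8, prod_encode (X, enc_mso p))"

definition enc_trans :: "nat \<times> nat \<times> op2 \<times> nat \<Rightarrow> nat" where
  "enc_trans t = (case t of (q, a, o1, q') \<Rightarrow>
     list_encode [q, a, enc_op o1, q'])"

fun enc_cpds :: "cpds \<Rightarrow> nat" where
  "enc_cpds (CPDS Q S Alph Delta q0 F) =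
     list_encode [list_encode Q, list_encode S, list_encode Alph,
                  list_encode (map enc_trans Delta), q0, list_encode F]"

definition enc_sat_inst :: "nat list \<times> mso \<Rightarrow> nat" where
  "enc_sat_inst x = prod_encode (list_encode (fst x), enc_mso (snd x))"

definition enc_mc_inst :: "mso \<times> cpds \<Rightarrow> nat" where
  "enc_mc_inst x = prod_encode (enc_mso (fst x), enc_cpds (snd x))"

definition MSO_SAT :: "nat list \<times> mso \<Rightarrow> bool" where
  "MSO_SAT x \<longleftrightarrow> (\<exists>N. is_2NW (fst x) N \<and> models N (snd x))"

definition CPDS_MC :: "mso \<times> cpds \<Rightarrow> bool" where
  "CPDS_MC x \<longleftrightarrow> (\<forall>N \<in> lang (snd x). models N (fst x))"

end

theory Submission
  imports Defs
begin

text \<open>Positions of a nested word serve as natural numbers, and a set of positions serves as a binary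
  relation through an MSO-definable pairing \<open>pairs x y p\<close>. Every recursive function \<open>h\<close> thereby
  translates into a formula for its graph. The translation is sound on every nested word, because
  it never relies on the pairing being correct, and it is complete on large grid words, where
  every pair \<open>(x, y)\<close> of small positions has a code \<open>p\<close> of its own. The sentence saying that
  \<open>h\<close> halts on \<open>n\<close> splits into a formula depending only on \<open>h\<close> and one saying \<open>x = n\<close>;
  plugging in for \<open>n\<close> the code of the first formula gives a computable diagonal, so that
  programs need not be coded at all.\<close>

section \<open>Determinism and some recursive functions\<close>

inductive_cases eval_ZE: "eval Z xs y"
inductive_cases eval_ScE: "eval Sc xs y"
inductive_cases eval_ProjE: "eval (Proj i) xs y"
inductive_cases eval_CnE: "eval (Cn f gs) xs y"
inductive_cases eval_Pr0E: "eval (Pr f g) (0 # xs) y"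
inductive_cases eval_PrSE: "eval (Pr f g) (Suc n # xs) y"
inductive_cases eval_MnE: "eval (Mn f) xs y"

lemma eval_deterministic: "eval h xs y \<Longrightarrow> eval h xs y' \<Longrightarrow> y = y'"
proof (induction arbitrary: y' rule: eval.induct)
  case (eval_Cn xs gs ys f z)
  from eval_Cn.prems obtain ys' where ys': "list_all2 (\<lambda>g y. eval g xs y) gs ys'" "eval f ys' y'"
    by (auto elim: eval_CnE)
  have "ys = ys'"
    using eval_Cn.IH(1) ys'(1) by (auto simp: list_all2_conv_all_nth intro!: nth_equalityI)
  then show ?case using eval_Cn.IH(2) ys'(2) by simp
next
  case (eval_PrS f g n xs y z)
  then show ?case by (metis eval_PrSE)
next
  case (eval_Mn f n xs)
  from eval_Mn.prems have y': "eval f (y' # xs) 0" "\<forall>m<y'. \<exists>y. 0 < y \<and> eval f (m # xs) y"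
    by (auto elim: eval_MnE)
  have "\<not> n < y'" using eval_Mn.IH(1) y'(2) by fastforce
  moreover have "\<not> y' < n" using eval_Mn.IH(2) y'(1) by fastforce
  ultimately show ?case by simp
next
  case (eval_Pr0 f xs y g)
  then show ?case by (blast elim: eval_Pr0E)
qed (erule eval_ZE eval_ScE eval_ProjE; simp)+

lemma eval_Cn1: "eval g xs a \<Longrightarrow> eval f [a] z \<Longrightarrow> eval (Cn f [g]) xs z"
  by (rule eval_Cn[where ys = "[a]"]) auto

lemma eval_Cn2: "eval g xs a \<Longrightarrow> eval h xs b \<Longrightarrow> eval f [a, b] z \<Longrightarrow> eval (Cn f [g, h]) xs z"
  by (rule eval_Cn[where ys = "[a, b]"]) auto

lemma eval_Proj_eq: "i < length xs \<Longrightarrow> y = xs ! i \<Longrightarrow> eval (Proj i) xs y"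
  using eval_Proj by simp

section \<open>Recursive functions for constants, sums and pair codes\<close>

fun rconst :: "nat \<Rightarrow> recf" where
  "rconst 0 = Z"
| "rconst (Suc n) = Cn Sc [rconst n]"

lemma eval_rconst: "eval (rconst n) xs n"
  by (induction n) (auto intro: eval_Z eval_Cn1 eval_Sc)

definition radd :: recf where "radd = Pr (Proj 0) (Cn Sc [Proj 1])"

lemma eval_radd: "eval radd [m, n] (m + n)"
  unfolding radd_def
proof (induction m)
  case 0
  show ?case by (auto intro!: eval_Pr0 eval_Proj_eq)
next
  case (Suc m)
  have "eval (Cn Sc [Proj 1]) [m, m + n, n] (Suc (m + n))"
    by (rule eval_Cn1[OF eval_Proj_eq eval_Sc]) auto
  then show ?case using eval_PrS[OF Suc] by simp
qed

definition rtriangle :: recf where "rtriangle = Pr Z (Cn radd [Proj 1, Cn Sc [Proj 0]])"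

lemma eval_rtriangle: "eval rtriangle [n] (triangle n)"
  unfolding rtriangle_def
proof (induction n)
  case 0
  show ?case by (auto intro!: eval_Pr0 eval_Z)
next
  case (Suc n)
  have "eval (Cn radd [Proj 1, Cn Sc [Proj 0]]) [n, triangle n] (triangle n + Suc n)"
    by (rule eval_Cn2[OF eval_Proj_eq eval_Cn1[OF eval_Proj_eq eval_Sc] eval_radd]) auto
  then show ?case using eval_PrS[OF Suc] by simp
qed

text \<open>\<open>prod_encode (a, b)\<close> is \<open>triangle (a + b) + a\<close>.\<close>

definition rpair :: "recf \<Rightarrow> recf \<Rightarrow> recf" where
  "rpair f g = Cn radd [Cn rtriangle [Cn radd [f, g]], f]"

lemma eval_rpair: "eval f xs a \<Longrightarrow> eval g xs b \<Longrightarrow> eval (rpair f g) xs (prod_encode (a, b))"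
  unfolding rpair_def prod_encode_def prod.case
  by (rule eval_Cn2[OF eval_Cn1[OF eval_Cn2[OF _ _ eval_radd] eval_rtriangle] _ eval_radd])

definition risz :: recf where "risz = Pr (rconst 1) Z"

lemma eval_risz: "eval risz [n] (if n = 0 then 1 else 0)"
proof (induction n)
  case 0
  show ?case using eval_Pr0[OF eval_rconst, of 1 Z "[]"] by (simp add: risz_def)
next
  case (Suc n)
  then show ?case unfolding risz_def using eval_PrS[OF _ eval_Z] by fastforce
qed

text \<open>Unbounded search over a function that ignores its search variable stops at once if
  \<open>g x = 0\<close> and otherwise never finds a zero. This turns the answer 0 of a decider into
  halting.\<close>

lemma exists_halting_iff_zero:
  assumes c: "\<And>x. eval c [enc x] (code x)" and f: "\<And>x. P x \<Longrightarrow> eval f [code x] (g x)"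
  shows "\<exists>d. \<forall>x. P x \<longrightarrow> ((\<exists>y. eval d [enc x] y) \<longleftrightarrow> g x = 0)"
proof -
  define b where "b = Cn f [Cn c [Proj 1]]"
  have b: "eval b [m, enc x] (g x)" if "P x" for m x
    unfolding b_def by (rule eval_Cn1[OF eval_Cn1[OF eval_Proj_eq c] f[OF that]]) auto
  have "(\<exists>y. eval (Mn b) [enc x] y) \<longleftrightarrow> g x = 0" if "P x" for x
  proof
    assume "\<exists>y. eval (Mn b) [enc x] y"
    then obtain y where "eval b [y, enc x] 0" by (auto elim: eval_MnE)
    then show "g x = 0" using b[OF that] eval_deterministic by blast
  next
    assume "g x = 0"
    then have "eval (Mn b) [enc x] 0" using b[OF that, of 0] by (auto intro: eval_Mn)
    then show "\<exists>y. eval (Mn b) [enc x] y" ..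
  qed
  then show ?thesis by blast
qed

section \<open>Derived connectives\<close>

definition And :: "mso \<Rightarrow> mso \<Rightarrow> mso" where "And p q = Neg (Or (Neg p) (Neg q))"
definition All :: "nat \<Rightarrow> mso \<Rightarrow> mso" where "All x p = Neg (ExFO x (Neg p))"
definition Eq :: "nat \<Rightarrow> nat \<Rightarrow> mso" where "Eq x y = Neg (Or (Less x y) (Less y x))"
text \<open>A false formula without free variables. It translates calls with too few arguments, for
  which \<open>eval\<close> has no rule either.\<close>

definition FF :: "nat \<Rightarrow> mso" where "FF k = ExFO k (Less k k)"

text \<open>In the following formulas and in \<open>tr\<close>, the argument \<open>k\<close> is larger than all
  variables in use, so that the variables from \<open>k\<close> on may be quantified.\<close>

definition IsZero :: "nat \<Rightarrow> nat \<Rightarrow> mso" where "IsZero x k = All k (Neg (Less k x))"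

definition IsSucc :: "nat \<Rightarrow> nat \<Rightarrow> nat \<Rightarrow> mso" where
  "IsSucc x y k = And (Less x y) (Neg (ExFO k (And (Less x k) (Less k y))))"

text \<open>Designed for grid words: \<open>x\<close> is the push matched with \<open>p\<close>, and
  \<open>y\<close> the push matched with the letter-1 position \<open>k\<close> in the row of
  \<open>p\<close>. As letter 2 starts a row, being in one row means that no letter 2 separates
  \<open>p\<close> and \<open>k\<close>.\<close>

definition Pair :: "nat \<Rightarrow> nat \<Rightarrow> nat \<Rightarrow> nat \<Rightarrow> mso" where
  "Pair x y p k = And (Nest1 x p) (ExFO k (And (Lt 1 k) (And (Nest1 y k)
     (Neg (ExFO (Suc k) (And (Lt 2 (Suc k))
        (Or (And (Less p (Suc k)) (Neg (Less k (Suc k))))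
            (And (Less k (Suc k)) (Neg (Less p (Suc k)))))))))))"

text \<open>Set variable 0 is the only one in the translation. Nested recursions can rebind it
  because no formula \<open>tr h xs y k\<close> has a free set variable.\<close>

definition Rel :: "nat \<Rightarrow> nat \<Rightarrow> nat \<Rightarrow> mso" where
  "Rel x y k = ExFO k (And (Mem k 0) (Pair x y k (Suc k)))"

fun Conj :: "mso list \<Rightarrow> nat \<Rightarrow> mso" where
  "Conj [] k = Neg (FF k)"
| "Conj (p # ps) k = And p (Conj ps k)"

fun Exs :: "nat \<Rightarrow> nat \<Rightarrow> mso \<Rightarrow> mso" where
  "Exs k 0 p = p"
| "Exs k (Suc m) p = ExFO k (Exs (Suc k) m p)"

lemma fv_derived [simp]:
  "fv1 (And p q) = fv1 p \<union> fv1 q" "fv2 (And p q) = fv2 p \<union> fv2 q"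
  "letters (And p q) = letters p \<union> letters q"
  "fv1 (All x p) = fv1 p - {x}" "fv2 (All x p) = fv2 p" "letters (All x p) = letters p"
  "fv1 (Eq x y) = {x, y}" "fv2 (Eq x y) = {}" "letters (Eq x y) = {}"
  "fv1 (FF k) = {}" "fv2 (FF k) = {}" "letters (FF k) = {}"
  "x < k \<Longrightarrow> fv1 (IsZero x k) = {x}" "fv2 (IsZero x k) = {}" "letters (IsZero x k) = {}"
  "x < k \<Longrightarrow> y < k \<Longrightarrow> fv1 (IsSucc x y k) = {x, y}"
  "fv2 (IsSucc x y k) = {}" "letters (IsSucc x y k) = {}"
  "x < k \<Longrightarrow> y < k \<Longrightarrow> z < k \<Longrightarrow> fv1 (Pair x y z k) = {x, y, z}"
  "fv2 (Pair x y z k) = {}" "letters (Pair x y z k) = {1, 2}"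
  "x < k \<Longrightarrow> y < k \<Longrightarrow> fv1 (Rel x y k) = {x, y}"
  "fv2 (Rel x y k) = {0}" "letters (Rel x y k) = {1, 2}"
  by (auto simp: And_def All_def Eq_def FF_def IsZero_def IsSucc_def Pair_def Rel_def)

lemma fv_Conj [simp]:
  "fv1 (Conj ps k) = \<Union> (fv1 ` set ps)" "fv2 (Conj ps k) = \<Union> (fv2 ` set ps)"
  "letters (Conj ps k) = \<Union> (letters ` set ps)"
  by (induction ps) auto

lemma fv_Exs [simp]:
  "fv1 (Exs k m p) = fv1 p - {k..<k + m}" "fv2 (Exs k m p) = fv2 p"
  "letters (Exs k m p) = letters p"
  by (induction m arbitrary: k) auto

section \<open>Semantics of the derived formulas\<close>

fun pairs :: "nw2 \<Rightarrow> nat \<Rightarrow> nat \<Rightarrow> nat \<Rightarrow> bool" where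
  "pairs (w, R1, R2) x y p \<longleftrightarrow> R1 x p \<and> (\<exists>d < length w. w ! d = 1 \<and> R1 y d \<and>
     \<not> (\<exists>r < length w. w ! r = 2 \<and> (p < r \<and> r \<le> d \<or> d < r \<and> r \<le> p)))"

definition rel :: "(nat \<Rightarrow> nat \<Rightarrow> nat \<Rightarrow> bool) \<Rightarrow> nat set \<Rightarrow> nat \<Rightarrow> nat \<Rightarrow> bool" where
  "rel Q F x y \<longleftrightarrow> (\<exists>p\<in>F. Q x y p)"

lemma holds_Or_Neg [simp]:
  "holds N I J (Or p q) \<longleftrightarrow> holds N I J p \<or> holds N I J q"
  "holds N I J (Neg p) \<longleftrightarrow> \<not> holds N I J p"
  "holds N I J (Mem x X) \<longleftrightarrow> I x \<in> J X"
  by (cases N; simp)+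

lemma holds_derived [simp]:
  "holds N I J (And p q) \<longleftrightarrow> holds N I J p \<and> holds N I J q"
  "holds (w, R1, R2) I J (All x p) \<longleftrightarrow> (\<forall>v<length w. holds (w, R1, R2) (I(x := v)) J p)"
  "holds (w, R1, R2) I J (Eq x y) \<longleftrightarrow> I x = I y"
  "\<not> holds (w, R1, R2) I J (FF k)"
  "holds N I J (Conj ps k) \<longleftrightarrow> (\<forall>p\<in>set ps. holds N I J p)"
proof -
  show ff: "\<not> holds (w, R1, R2) I J (FF k)" for w R1 R2 by (simp add: FF_def)
  show "holds N I J (Conj ps k) \<longleftrightarrow> (\<forall>p\<in>set ps. holds N I J p)"
    using ff by (induction ps; cases N) (auto simp: And_def)
qed (auto simp: And_def All_def Eq_def)

lemma holds_IsZero [simp]: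
  "I x < length w \<Longrightarrow> x < k \<Longrightarrow> holds (w, R1, R2) I J (IsZero x k) \<longleftrightarrow> I x = 0"
  by (auto simp: IsZero_def) (metis gr_zeroI less_trans)

lemma holds_IsSucc [simp]:
  assumes "I y < length w" "x < k" "y < k"
  shows "holds (w, R1, R2) I J (IsSucc x y k) \<longleftrightarrow> I y = Suc (I x)"
proof -
  have "holds (w, R1, R2) I J (IsSucc x y k) \<longleftrightarrow>
      I x < I y \<and> \<not> (\<exists>v<length w. I x < v \<and> v < I y)"
    using assms by (simp add: IsSucc_def)
  also have "\<dots> \<longleftrightarrow> I y = Suc (I x)"
  proof
    assume *: "I x < I y \<and> \<not> (\<exists>v<length w. I x < v \<and> v < I y)"
    then have "\<not> Suc (I x) < I y" using assms(1) less_trans by blast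
    then show "I y = Suc (I x)" using * by simp
  qed auto
  finally show ?thesis .
qed

lemma holds_Rel [simp]:
  assumes "x < k" "y < k" "J 0 \<subseteq> {..<length w}"
  shows "holds (w, R1, R2) I J (Rel x y k) \<longleftrightarrow> rel (pairs (w, R1, R2)) (J 0) (I x) (I y)"
  using assms by (auto simp: Rel_def Pair_def rel_def not_less)

declare pairs.simps [simp del]

lemma holds_Exs:
  "holds (w, R1, R2) I J (Exs k m p) \<longleftrightarrow> (\<exists>ys. length ys = m \<and> set ys \<subseteq> {..<length w} \<and>
     holds (w, R1, R2) (\<lambda>v. if k \<le> v \<and> v < k + m then ys ! (v - k) else I v) J p)"
proof (induction m arbitrary: k I)
  case 0
  have "(\<lambda>v. if k \<le> v \<and> v < k + 0 then [] ! (v - k) else I v) = I" by auto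
  then show ?case by simp
next
  case (Suc m)
  \<comment> \<open>Binding \<open>k\<close> and then the block from \<open>Suc k\<close> on amounts
    to binding the block from \<open>k\<close> on to the longer list.\<close>
  have eq: "(\<lambda>v. if Suc k \<le> v \<and> v < Suc k + m then ys ! (v - Suc k) else (I(k := a)) v) =
      (\<lambda>v. if k \<le> v \<and> v < k + Suc m then (a # ys) ! (v - k) else I v)" for a ys
  proof
    fix v
    consider "v < k" | "v = k" | u where "v = Suc u" "k \<le> u"
      by (metis not_less_eq not_less less_antisym less_imp_Suc_add le_add1)
    then show "(if Suc k \<le> v \<and> v < Suc k + m then ys ! (v - Suc k) else (I(k := a)) v) =
        (if k \<le> v \<and> v < k + Suc m then (a # ys) ! (v - k) else I v)"
      by cases (auto simp: Suc_diff_le)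
  qed
  show ?case
    unfolding length_Suc_conv Exs.simps holds.simps Suc.IH eq by force
qed

section \<open>Translating recursive functions into formulas\<close>

text \<open>\<open>xs\<close> holds the argument variables and \<open>y\<close> is the result
  variable. For \<open>Pr\<close>, each pair in the guessed set must be justified locally: by
  \<open>f\<close> at 0, or by \<open>g\<close> from a pair of the set whose first component is the
  predecessor. Induction on the first component then makes every pair correct.\<close>

primrec tr :: "recf \<Rightarrow> nat list \<Rightarrow> nat \<Rightarrow> nat \<Rightarrow> mso" where
  "tr Z = (\<lambda>xs y k. IsZero y k)"
| "tr Sc = (\<lambda>xs y k. if xs = [] then FF k else IsSucc (hd xs) y k)"
| "tr (Proj i) = (\<lambda>xs y k. if i < length xs then Eq y (xs ! i) else FF k)"
| "tr (Cn f gs) = (\<lambda>xs y k. let m = length gs in Exs k m (And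
     (Conj (map2 (\<lambda>T z. T xs z (k + m)) (map tr gs) [k..<k + m]) (k + m))
     (tr f [k..<k + m] y (k + m))))"
| "tr (Pr f g) = (\<lambda>xs y k. if xs = [] then FF k else
     ExSO 0 (And (Rel (hd xs) y k) (All k (All (k + 1) (Or (Neg (Rel k (k + 1) (k + 2)))
       (Or (And (IsZero k (k + 2)) (tr f (tl xs) (k + 1) (k + 2)))
           (ExFO (k + 2) (ExFO (k + 3) (And (IsSucc (k + 2) k (k + 4))
             (And (Rel (k + 2) (k + 3) (k + 4))
                  (tr g ((k + 2) # (k + 3) # tl xs) (k + 1) (k + 4))))))))))))"
| "tr (Mn f) = (\<lambda>xs y k.
     And (ExFO k (And (IsZero k (k + 1)) (tr f (y # xs) k (k + 1))))
         (All k (Or (Neg (Less k y)) (ExFO (k + 1)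
            (And (Neg (IsZero (k + 1) (k + 2))) (tr f (k # xs) (k + 1) (k + 2)))))))"

text \<open>The meaning of \<open>tr\<close> in a nested word of length \<open>L\<close> with definable pairing \<open>Q\<close>;
  primitive recursion guesses a set of positions that is read as (part of) its graph.\<close>

primrec sem :: "nat \<Rightarrow> (nat \<Rightarrow> nat \<Rightarrow> nat \<Rightarrow> bool) \<Rightarrow> recf \<Rightarrow> nat list \<Rightarrow> nat \<Rightarrow> bool" where
  "sem L Q Z = (\<lambda>vs v. v = 0)"
| "sem L Q Sc = (\<lambda>vs v. vs \<noteq> [] \<and> v = Suc (hd vs))"
| "sem L Q (Proj i) = (\<lambda>vs v. i < length vs \<and> v = vs ! i)"
| "sem L Q (Cn f gs) = (\<lambda>vs v. \<exists>ys. set ys \<subseteq> {..<L} \<and>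
     list_all2 (\<lambda>S y. S vs y) (map (sem L Q) gs) ys \<and> sem L Q f ys v)"
| "sem L Q (Pr f g) = (\<lambda>vs v. vs \<noteq> [] \<and> (\<exists>F\<subseteq>{..<L}. rel Q F (hd vs) v \<and>
     (\<forall>i<L. \<forall>u<L. rel Q F i u \<longrightarrow> i = 0 \<and> sem L Q f (tl vs) u \<or>
        (\<exists>j<L. \<exists>t<L. i = Suc j \<and> rel Q F j t \<and> sem L Q g (j # t # tl vs) u))))"
| "sem L Q (Mn f) = (\<lambda>vs v. sem L Q f (v # vs) 0 \<and>
     (\<forall>m<L. m < v \<longrightarrow> (\<exists>u<L. u \<noteq> 0 \<and> sem L Q f (m # vs) u)))"

section \<open>Free variables and correctness of the translation\<close>

lemma fv_tr:
  "set xs \<subseteq> {..<k} \<Longrightarrow> y < k \<Longrightarrow>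
     fv1 (tr h xs y k) \<subseteq> insert y (set xs) \<and> fv2 (tr h xs y k) = {} \<and> letters (tr h xs y k) \<subseteq> {1, 2}"
proof (induction h arbitrary: xs y k)
  case (Cn f gs)
  let ?m = "length gs"
  have f: "fv1 (tr f [k..<k + ?m] y (k + ?m)) \<subseteq> insert y {k..<k + ?m} \<and>
      fv2 (tr f [k..<k + ?m] y (k + ?m)) = {} \<and> letters (tr f [k..<k + ?m] y (k + ?m)) \<subseteq> {1, 2}"
    using Cn.IH(1)[of "[k..<k + ?m]" "k + ?m" y] Cn.prems by (simp add: subset_iff)
  have g: "fv1 (tr g xs z (k + ?m)) \<subseteq> insert z (set xs) \<and>
      fv2 (tr g xs z (k + ?m)) = {} \<and> letters (tr g xs z (k + ?m)) \<subseteq> {1, 2}"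
    if "g \<in> set gs" "z < k + ?m" for g z
    by (rule Cn.IH(2)) (use that Cn.prems in auto)
  have "fv1 p \<subseteq> {k..<k + ?m} \<union> set xs \<and> fv2 p = {} \<and> letters p \<subseteq> {1, 2}"
    if "p \<in> set (map2 (\<lambda>T z. T xs z (k + ?m)) (map tr gs) [k..<k + ?m])" for p
  proof -
    from that obtain i where "i < ?m" "p = tr (gs ! i) xs (k + i) (k + ?m)"
      by (auto simp: in_set_conv_nth)
    then show ?thesis using g[of "gs ! i" "k + i"] by fastforce
  qed
  then show ?case using f by (simp add: Let_def) blast
next
  case (Pr f g)
  show ?case
  proof (cases xs)
    case (Cons x xs')
    have "set xs' \<subseteq> {..<k + 2}" "set ((k + 2) # (k + 3) # xs') \<subseteq> {..<k + 4}" "k + 1 < k + 2" "k + 1 < k + 4"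
      using Pr.prems Cons by auto
    note IH = Pr.IH(1)[OF this(1,3)] Pr.IH(2)[OF this(2,4)]
    show ?thesis using IH Pr.prems Cons by auto
  qed simp
next
  case (Mn f)
  have "set (y # xs) \<subseteq> {..<k + 1}" "set (k # xs) \<subseteq> {..<k + 2}" "k < k + 1" "k + 1 < k + 2"
    using Mn.prems by auto
  note IH = Mn.IH[OF this(1,3)] Mn.IH[OF this(2,4)]
  show ?case using IH Mn.prems by auto
qed (auto simp: subset_iff)

lemma map_if_fresh:
  "c \<notin> set xs \<Longrightarrow> map (\<lambda>a. if a = c then v else F a) xs = map F xs"
  by auto

text \<open>Quantifiers range over positions, so every variable has to hold one. \<open>J\<close>
  stays arbitrary in the induction and is absent from the right-hand side, so rebinding set variable
  0 inside a subformula does no harm.\<close>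

lemma holds_tr:
  assumes "set xs \<subseteq> {..<k}" "y < k" "\<forall>v. I v < length w"
  shows "holds (w, R1, R2) I J (tr h xs y k) \<longleftrightarrow>
    sem (length w) (pairs (w, R1, R2)) h (map I xs) (I y)"
  using assms
proof (induction h arbitrary: xs y k I J)
  case Sc
  then show ?case by (cases xs) auto
next
  case (Cn f gs)
  let ?m = "length gs" let ?N = "(w, R1, R2)" let ?S = "sem (length w) (pairs ?N)"
  have body: "holds ?N I' J (And
        (Conj (map2 (\<lambda>T z. T xs z (k + ?m)) (map tr gs) [k..<k + ?m]) (k + ?m))
        (tr f [k..<k + ?m] y (k + ?m))) \<longleftrightarrow>
      list_all2 (\<lambda>S y. S (map I xs) y) (map ?S gs) ys \<and> ?S f ys (I y)"
    if ys: "length ys = ?m" "set ys \<subseteq> {..<length w}"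
      and I': "I' = (\<lambda>v. if k \<le> v \<and> v < k + ?m then ys ! (v - k) else I v)" for ys I'
  proof -
    have lt: "\<forall>v. I' v < length w"
      using ys Cn.prems(3) by (auto simp: I' subset_iff)
    have xs: "map I' xs = map I xs" and y: "I' y = I y"
      using Cn.prems by (auto simp: I' subset_iff)
    have zs: "map I' [k..<k + ?m] = ys"
      using ys by (auto simp: I' intro: nth_equalityI)
    have f: "holds ?N I' J (tr f [k..<k + ?m] y (k + ?m)) \<longleftrightarrow> ?S f ys (I y)"
      using Cn.IH(1)[of "[k..<k + ?m]" "k + ?m" y I' J] Cn.prems lt zs y
      by (simp add: subset_iff)
    have g: "holds ?N I' J (tr (gs ! i) xs (k + i) (k + ?m)) \<longleftrightarrow> ?S (gs ! i) (map I xs) (ys ! i)"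
      if "i < ?m" for i
    proof -
      have "set xs \<subseteq> {..<k + ?m}" using Cn.prems by auto
      moreover have "I' (k + i) = ys ! i" using that by (simp add: I')
      ultimately show ?thesis
        using Cn.IH(2)[of "gs ! i" xs "k + ?m" "k + i" I' J] that lt xs by simp
    qed
    have "(\<forall>p\<in>set (map2 (\<lambda>T z. T xs z (k + ?m)) (map tr gs) [k..<k + ?m]). holds ?N I' J p) \<longleftrightarrow>
        (\<forall>i<?m. holds ?N I' J (tr (gs ! i) xs (k + i) (k + ?m)))"
      by (auto simp: all_set_conv_all_nth)
    then show ?thesis using f g ys(1) by (simp add: list_all2_conv_all_nth)
  qed
  show ?case
    unfolding tr.simps sem.simps Let_def holds_Exs
  proof (intro ex_cong1)
    fix ys
    let ?A = "length ys = ?m" and ?B = "set ys \<subseteq> {..<length w}"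
    let ?C = "list_all2 (\<lambda>S y. S (map I xs) y) (map ?S gs) ys"
    \<comment> \<open>The quantifier block fixes the length of \<open>ys\<close>; in
      \<open>sem\<close> the length is implied by \<open>list_all2\<close>.\<close>
    have "?C \<Longrightarrow> ?A" by (auto dest: list_all2_lengthD)
    then show "(?A \<and> ?B \<and> holds ?N (\<lambda>v. if k \<le> v \<and> v < k + ?m then ys ! (v - k) else I v) J
        (And (Conj (map2 (\<lambda>T z. T xs z (k + ?m)) (map tr gs) [k..<k + ?m]) (k + ?m))
          (tr f [k..<k + ?m] y (k + ?m)))) = (?B \<and> ?C \<and> ?S f ys (I y))"
      using body[OF _ _ refl, of ys] by blast
  qed
next
  case (Pr f g)
  show ?case
  proof (cases xs)
    case (Cons x xs')
    have s: "set xs' \<subseteq> {..<k + 2}" "set ((k + 2) # (k + 3) # xs') \<subseteq> {..<k + 4}" "x < k"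
      "k \<notin> set xs'" "Suc k \<notin> set xs'" "Suc (Suc k) \<notin> set xs'" "k + 3 \<notin> set xs'" "0 < length w"
      using Pr.prems Cons by (auto intro: le_less_trans)
    show ?thesis
      using Pr.prems Cons s by (simp add: Pr.IH map_if_fresh cong: conj_cong)
  qed simp
next
  case (Mn f)
  have "set (y # xs) \<subseteq> {..<k + 1}" "set (k # xs) \<subseteq> {..<k + 2}" "k \<notin> set xs" "Suc k \<notin> set xs" "0 < length w"
    using Mn.prems by (auto intro: le_less_trans)
  then show ?case using Mn.prems by (simp add: Mn.IH map_if_fresh cong: conj_cong)
qed auto

text \<open>\<open>Q\<close> is arbitrary: a set accepted by the clause for \<open>Pr\<close>
  certifies its own pairs, whichever positions code them. The other clauses mirror the rules of
  \<open>eval\<close> with bounded values.\<close>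

lemma sem_sound:
  "sem L Q h vs v \<Longrightarrow> set vs \<subseteq> {..<L} \<Longrightarrow> v < L \<Longrightarrow> eval h vs v"
proof (induction h arbitrary: vs v)
  case Sc
  then show ?case by (cases vs) (auto intro: eval_Sc)
next
  case (Cn f gs)
  then obtain ys where ys: "set ys \<subseteq> {..<L}" "list_all2 (\<lambda>g y. sem L Q g vs y) gs ys" "sem L Q f ys v"
    by (auto simp: list.rel_map)
  have "list_all2 (\<lambda>g y. eval g vs y) gs ys"
    using ys(1,2) Cn.IH(2) Cn.prems(2) by (auto simp: list_all2_conv_all_nth subset_iff)
  then show ?case using Cn.IH(1)[OF ys(3,1)] Cn.prems by (auto intro: eval_Cn)
next
  case (Pr f g)
  then obtain n us where vs: "vs = n # us" by (cases vs) auto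
  with Pr.prems obtain F where F: "rel Q F n v"
    "\<And>i u. i < L \<Longrightarrow> u < L \<Longrightarrow> rel Q F i u \<Longrightarrow> i = 0 \<and> sem L Q f us u \<or>
        (\<exists>j<L. \<exists>t<L. i = Suc j \<and> rel Q F j t \<and> sem L Q g (j # t # us) u)"
    by auto
  have us: "set us \<subseteq> {..<L}" "n < L" using Pr.prems vs by auto
  \<comment> \<open>The claim covers all pairs of \<open>F\<close>, since the justification of
    \<open>(Suc i, u)\<close> leads to some other pair \<open>(i, t)\<close> of
    \<open>F\<close>.\<close>
  have "eval (Pr f g) (i # us) u" if "i < L" "u < L" "rel Q F i u" for i u
    using that
  proof (induction i arbitrary: u)
    case 0
    then show ?case using F(2)[of 0 u] us Pr.IH(1) by (auto intro: eval_Pr0)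
  next
    case (Suc i)
    from F(2)[OF Suc.prems] obtain t where "t < L" "rel Q F i t" "sem L Q g (i # t # us) u" by auto
    then show ?case using Suc us Pr.IH(2)[of "i # t # us" u] by (auto intro: eval_PrS)
  qed
  then show ?case using F(1) us vs Pr.prems by simp
next
  case (Mn f)
  have "\<exists>y. 0 < y \<and> eval f (m # vs) y" if m: "m < v" for m
  proof -
    have "m < L" using m Mn.prems by simp
    moreover have "\<forall>m<L. m < v \<longrightarrow> (\<exists>u<L. u \<noteq> 0 \<and> sem L Q f (m # vs) u)"
      using Mn.prems(1) by simp
    ultimately obtain u where "u < L" "u \<noteq> 0" "sem L Q f (m # vs) u" using m by blast
    then show ?thesis using Mn.IH[of "m # vs" u] Mn.prems(2) \<open>m < L\<close> by auto
  qed
  moreover have "eval f (v # vs) 0" using Mn.prems Mn.IH[of "v # vs" 0] by auto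
  ultimately show ?case by (auto intro: eval_Mn)
qed (auto intro: eval_Z eval_Proj)

text \<open>A derivation of \<open>eval\<close> involves finitely many numbers, so from some
  \<open>N\<close> on they and the codes of their pairs all fit below \<open>L N\<close>; the filter
  collects these bounds without naming them.\<close>

lemma sem_complete:
  fixes L :: "nat \<Rightarrow> nat"
  assumes L: "\<And>N. N \<le> L N"
    and pair: "\<And>N x y. x < N \<Longrightarrow> y < N \<Longrightarrow> \<exists>p<L N. \<forall>x' y'. Q N x' y' p \<longleftrightarrow> x' = x \<and> y' = y"
  shows "eval h vs v \<Longrightarrow> \<forall>\<^sub>F N in sequentially. sem (L N) (Q N) h vs v"
proof (induction rule: eval.induct)
  case (eval_Cn xs gs ys f z)
  have len: "length gs = length ys" using eval_Cn.IH(1) by (rule list_all2_lengthD)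
  have "\<forall>\<^sub>F N in sequentially. \<forall>i\<in>{..<length gs}. sem (L N) (Q N) (gs ! i) xs (ys ! i)"
    using eval_Cn.IH(1) by (intro eventually_ball_finite) (auto simp: list_all2_conv_all_nth)
  moreover have "\<forall>\<^sub>F N in sequentially. \<forall>y\<in>set ys. y < N"
    by (intro eventually_ball_finite) (auto intro: eventually_gt_at_top)
  ultimately show ?case
    using eval_Cn.IH(2)
  proof eventually_elim
    case (elim N)
    have "set ys \<subseteq> {..<L N}" using elim(2) L[of N] by auto
    then show ?case using elim len by (auto simp: list_all2_conv_all_nth intro!: exI[of _ ys])
  qed
next
  case (eval_Pr0 f xs y g)
  from eval_Pr0.IH eventually_gt_at_top[of 0] eventually_gt_at_top[of y] show ?case
  proof eventually_elim
    case (elim N)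
    from pair[OF elim(2,3)] obtain p where
      "p < L N" "\<forall>x' y'. Q N x' y' p \<longleftrightarrow> x' = 0 \<and> y' = y" by auto
    then show ?case using elim by (auto simp: rel_def intro!: exI[of _ "{p}"])
  qed
next
  case (eval_PrS f g n xs y z)
  from eval_PrS.IH eventually_gt_at_top[of "Suc n"] eventually_gt_at_top[of y] eventually_gt_at_top[of z]
  show ?case
  proof eventually_elim
    case (elim N)
    from pair[OF elim(3,5)] obtain p where
      p: "p < L N" "\<And>x' y'. Q N x' y' p \<longleftrightarrow> x' = Suc n \<and> y' = z" by auto
    from elim(1) obtain F where F: "F \<subseteq> {..<L N}" "rel (Q N) F n y"
      "\<And>i u. i < L N \<Longrightarrow> u < L N \<Longrightarrow> rel (Q N) F i u \<Longrightarrow> i = 0 \<and> sem (L N) (Q N) f xs u \<or>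
        (\<exists>j<L N. \<exists>t<L N. i = Suc j \<and> rel (Q N) F j t \<and> sem (L N) (Q N) g (j # t # xs) u)"
      by auto
    \<comment> \<open>\<open>p\<close> codes this pair and no other, so \<open>(Suc n, z)\<close> is
      the only possible new pair, and it is justified by \<open>(n, y)\<close>.\<close>
    have R: "rel (Q N) (insert p F) i u \<longleftrightarrow> i = Suc n \<and> u = z \<or> rel (Q N) F i u" for i u
      by (simp add: rel_def p)
    have "n < L N" "y < L N" using elim L[of N] by auto
    then have step: "i = 0 \<and> sem (L N) (Q N) f xs u \<or> (\<exists>j<L N. \<exists>t<L N. i = Suc j \<and>
        rel (Q N) (insert p F) j t \<and> sem (L N) (Q N) g (j # t # xs) u)"
      if "i < L N" "u < L N" "rel (Q N) (insert p F) i u" for i u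
      using that F(2) F(3)[of i u] elim(2) unfolding R by blast
    show ?case
      unfolding sem.simps list.sel
    proof (intro conjI exI[of _ "insert p F"] allI impI)
      show "insert p F \<subseteq> {..<L N}" using p(1) F(1) by auto
      show "rel (Q N) (insert p F) (Suc n) z" by (simp add: R)
    qed (simp, rule step)
  qed
next
  case (eval_Mn f n xs)
  \<comment> \<open>A nonzero value \<open>u m\<close> is fixed for each of the finitely many
    \<open>m < n\<close>, so that a single bound on \<open>N\<close> serves them all.\<close>
  then have "\<forall>m. \<exists>u. m < n \<longrightarrow>
      0 < u \<and> (\<forall>\<^sub>F N in sequentially. sem (L N) (Q N) f (m # xs) u)"
    by blast
  from choice[OF this] obtain u where u: "\<And>m. m < n \<Longrightarrow>
      0 < u m \<and> (\<forall>\<^sub>F N in sequentially. sem (L N) (Q N) f (m # xs) (u m))"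
    by blast
  have "\<forall>\<^sub>F N in sequentially. \<forall>m\<in>{..<n}. u m < N \<and> sem (L N) (Q N) f (m # xs) (u m)"
    using u by (intro eventually_ball_finite) (auto intro!: eventually_conj eventually_gt_at_top)
  with eval_Mn.IH(1) show ?case
  proof eventually_elim
    case (elim N)
    then show ?case using u L[of N] by (auto intro: less_le_trans dest!: bspec)
  qed
qed auto

section \<open>Grid words\<close>

text \<open>After pushing \<open>N\<close> symbols, the stack is \<open>N\<close> times copied, emptied by \<open>Pop1\<close> and dropped.
  The \<open>Pop1\<close> at offset \<open>t\<close> of such a row is matched with position \<open>N - t\<close>. Letter 2 marks the
  beginning of a row and letter 1 marks the diagonal: it links the rows to the columns.\<close>

definition grid_len :: "nat \<Rightarrow> nat" where "grid_len N = N + (N + 2) * N"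

definition grid_row :: "nat \<Rightarrow> nat \<Rightarrow> nat" where "grid_row N j = (j - N) div (N + 2)"

definition grid_offset :: "nat \<Rightarrow> nat \<Rightarrow> nat" where "grid_offset N j = (j - N) mod (N + 2)"

definition grid_op :: "nat \<Rightarrow> nat \<Rightarrow> op2" where
  "grid_op N j = (if j < N then Push1 0 else if grid_offset N j = 0 then Push2
     else if grid_offset N j = N + 1 then Pop2 else Pop1)"

text \<open>In row \<open>y < N\<close>, letter 1 falls on offset \<open>N - y\<close>, whose
  \<open>Pop1\<close> is matched with position \<open>y\<close>: each row points to its own
  number.\<close>

definition grid_letter :: "nat \<Rightarrow> nat \<Rightarrow> nat" where
  "grid_letter N j = (if j < N then 0 else if grid_offset N j = 0 then 2
     else if grid_offset N j + grid_row N j = N then 1 else 0)"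

definition grid_ops :: "nat \<Rightarrow> op2 list" where "grid_ops N = map (grid_op N) [0..<grid_len N]"

definition grid_word :: "nat \<Rightarrow> nat list" where "grid_word N = map (grid_letter N) [0..<grid_len N]"

definition grid :: "nat \<Rightarrow> nw2" where "grid N = nw_of (grid_word N) (grid_ops N)"

definition pushes :: "nat \<Rightarrow> letter1 list" where "pushes m = map (\<lambda>i. (0, 0, i)) [0..<m]"

text \<open>Closed form of the stack just before position \<open>j\<close>. At offset
  \<open>t > 0\<close> the copy has lost \<open>t - 1\<close> letters, and \<open>j - t\<close> is
  the position of its \<open>Push2\<close>.\<close>

definition grid_stack :: "nat \<Rightarrow> nat \<Rightarrow> stack2" where
  "grid_stack N j = (if j < N then [(None, pushes j)]
     else if grid_offset N j = 0 then [(None, pushes N)]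
     else [(None, pushes N), (Some (j - grid_offset N j), pushes (Suc N - grid_offset N j))])"

lemma pushes_simps [simp]:
  "pushes 0 = []" "pushes (Suc m) = pushes m @ [(0, 0, m)]" "pushes m = [] \<longleftrightarrow> m = 0"
  by (auto simp: pushes_def)

lemma grid_step: "exec_step j (grid_op N j) (grid_stack N j) = Some (grid_stack N (Suc j))"
proof (cases "j < N")
  case True
  show ?thesis
  proof (cases "Suc j < N")
    case False
    then have "N = Suc j" using True by simp
    then show ?thesis by (simp add: grid_op_def grid_stack_def grid_offset_def)
  qed (use True in \<open>simp add: grid_op_def grid_stack_def\<close>)
next
  case False
  let ?t = "grid_offset N j"
  have t: "?t < N + 2" by (simp add: grid_offset_def)
  have S: "grid_offset N (Suc j) = (if ?t = N + 1 then 0 else Suc ?t)"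
    using False by (simp add: grid_offset_def Suc_diff_le mod_Suc)
  consider "?t = 0" | "?t = N + 1" | s where "?t = Suc s" "s < N"
    using t by (cases ?t) (auto simp: less_Suc_eq)
  then show ?thesis
  proof cases
    case 3
    then obtain r where "N - s = Suc r" by (metis Suc_diff_Suc)
    moreover from this have "N - Suc s = r" by simp
    ultimately show ?thesis using 3 False by (simp add: grid_op_def grid_stack_def S)
  qed (use False in \<open>auto simp: grid_op_def grid_stack_def S\<close>)
qed

lemma exec_from_append:
  "exec_from j (xs @ ys) st = Option.bind (exec_from j xs st) (exec_from (j + length xs) ys)"
  by (induction xs arbitrary: j st) (auto split: option.split)

lemma grid_stack_before: "j \<le> grid_len N \<Longrightarrow> stack_before (grid_ops N) j = Some (grid_stack N j)"
proof (induction j)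
  case 0
  show ?case
    by (simp add: stack_before_def init_stack_def grid_stack_def grid_offset_def)
next
  case (Suc j)
  then have "take (Suc j) (grid_ops N) = take j (grid_ops N) @ [grid_op N j]"
    by (subst take_Suc_conv_app_nth) (auto simp: grid_ops_def)
  moreover have "length (take j (grid_ops N)) = j" using Suc.prems by (simp add: grid_ops_def)
  ultimately show ?case
    using Suc by (simp add: stack_before_def exec_from_append grid_step)
qed

lemma length_grid_ops: "length (grid_ops N) = grid_len N"
  by (simp add: grid_ops_def)

lemma valid_grid_ops: "valid_ops (grid_ops N)"
  using grid_stack_before[of "grid_len N" N]
  by (simp add: valid_ops_def stack_before_def grid_ops_def)

text \<open>\<open>Push2\<close> copies the letters with their push positions, so all rows pop the
  same \<open>N\<close> letters, the one at offset \<open>t\<close> having been pushed at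
  \<open>N - t\<close>. Each push is thus matched once in every row.\<close>

lemma nest1_grid:
  "nest1 (grid_ops N) i j \<longleftrightarrow> j < grid_len N \<and> N \<le> j \<and>
     0 < grid_offset N j \<and> grid_offset N j \<le> N \<and> i + grid_offset N j = N"
proof (cases "j < grid_len N \<and> N \<le> j \<and> 0 < grid_offset N j \<and> grid_offset N j \<le> N")
  case True
  then obtain r where r: "Suc N - grid_offset N j = Suc r" "N = r + grid_offset N j"
    by (metis Suc_diff_le le_add_diff_inverse2)
  have "grid_op N j = Pop1" using True by (simp add: grid_op_def)
  then show ?thesis
    using True r by (auto simp: nest1_def grid_stack_before grid_stack_def) (auto simp: grid_ops_def)
next
  case False
  have "grid_offset N j < N + 2" by (simp add: grid_offset_def)
  then have "\<not> (j < grid_len N \<and> grid_op N j = Pop1)"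
    using False by (auto simp: grid_op_def split: if_splits)
  then show ?thesis using False by (auto simp: nest1_def grid_ops_def)
qed

section \<open>Rows of the grid and the pairing they define\<close>

lemma grid_decompose: "N \<le> j \<Longrightarrow> j = N + (N + 2) * grid_row N j + grid_offset N j"
  using mult_div_mod_eq[of "N + 2" "j - N"] unfolding grid_row_def grid_offset_def by linarith

lemma grid_row_start:
  assumes "r = N + (N + 2) * k"
  shows "grid_letter N r = 2"
  using assms by (simp add: grid_letter_def grid_offset_def del: add_2_eq_Suc')

text \<open>Otherwise the start of the later row, which has letter 2, would separate the two
  positions.\<close>

lemma grid_same_row:
  assumes "N \<le> p" "N \<le> d" "p < grid_len N" "d < grid_len N"
    and no: "\<not> (\<exists>r < grid_len N. grid_letter N r = 2 \<and> (p < r \<and> r \<le> d \<or> d < r \<and> r \<le> p))"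
  shows "grid_row N p = grid_row N d"
proof -
  have "\<not> grid_row N a < grid_row N b" if "N \<le> a" "N \<le> b" "b < grid_len N"
    and no: "\<not> (\<exists>r < grid_len N. grid_letter N r = 2 \<and> a < r \<and> r \<le> b)" for a b
  proof
    assume less: "grid_row N a < grid_row N b"
    define r where "r = N + (N + 2) * grid_row N b"
    have "r \<le> b" using grid_decompose[OF that(2)] unfolding r_def by linarith
    moreover have "a < r"
    proof -
      have "(N + 2) * Suc (grid_row N a) \<le> (N + 2) * grid_row N b"
        using less by (intro mult_le_mono) auto
      moreover have "grid_offset N a < N + 2" by (simp add: grid_offset_def)
      ultimately show ?thesis using grid_decompose[OF that(1)] unfolding r_def by simp
    qed
    ultimately show False using no grid_row_start[OF r_def] that(3) by auto
  qed
  from this[of p d] this[of d p] show ?thesis using assms by (meson linorder_neqE_nat)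
qed

lemma length_grid_word [simp]: "length (grid_word N) = grid_len N"
  by (simp add: grid_word_def)

text \<open>The code of \<open>(x, y)\<close> is the \<open>Pop1\<close> of row \<open>y\<close>
  matched with \<open>x\<close>; the diagonal position of that row leads back to
  \<open>y\<close>.\<close>

lemma pairs_grid:
  assumes "x < N" "y < N" and p: "p = N + (N + 2) * y + (N - x)"
  shows "p < grid_len N" and "pairs (grid N) x' y' p \<longleftrightarrow> x' = x \<and> y' = y"
proof -
  have pos: "N \<le> q \<and> q < grid_len N \<and> grid_row N q = y \<and> grid_offset N q = N - z"
    if "q = N + (N + 2) * y + (N - z)" "z < N" for q z
  proof -
    have "(N + 2) * Suc y \<le> (N + 2) * N" using assms(2) by (intro mult_le_mono) auto
    then have "q < grid_len N" using that by (simp add: grid_len_def)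
    moreover have q: "q - N = (N - z) + (N + 2) * y" using that by simp
    have "grid_row N q = y" unfolding grid_row_def q by (subst div_mult_self2) simp_all
    moreover have "grid_offset N q = N - z"
      unfolding grid_offset_def q by (subst mod_mult_self2) simp
    ultimately show ?thesis using that(1) by simp
  qed
  note pp = pos[OF p assms(1)]
  show "p < grid_len N" using pp by simp
  have nth: "grid_word N ! j = grid_letter N j" if "j < grid_len N" for j
    using that by (simp add: grid_word_def)
  have iff: "pairs (grid N) x' y' p \<longleftrightarrow> nest1 (grid_ops N) x' p \<and>
      (\<exists>d < grid_len N. grid_letter N d = 1 \<and> nest1 (grid_ops N) y' d \<and>
        \<not> (\<exists>r < grid_len N. grid_letter N r = 2 \<and> (p < r \<and> r \<le> d \<or> d < r \<and> r \<le> p)))" for x' y'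
    unfolding grid_def nw_of_def pairs.simps length_grid_word
    by (simp add: nth cong: conj_cong)
  show "pairs (grid N) x' y' p \<longleftrightarrow> x' = x \<and> y' = y"
  proof
    assume "pairs (grid N) x' y' p"
    then obtain d where d: "nest1 (grid_ops N) x' p" "d < grid_len N" "grid_letter N d = 1"
        "nest1 (grid_ops N) y' d"
        "\<not> (\<exists>r < grid_len N. grid_letter N r = 2 \<and> (p < r \<and> r \<le> d \<or> d < r \<and> r \<le> p))"
      unfolding iff by blast
    have "N \<le> d" "y' + grid_offset N d = N" using d(4) by (auto simp: nest1_grid)
    moreover from this have "grid_row N d = y"
      using grid_same_row[of N p d] pp d(2,5) by simp
    moreover have "grid_offset N d + grid_row N d = N"
      using d(3) by (auto simp: grid_letter_def split: if_splits)
    moreover have "x' + (N - x) = N" using d(1) pp by (simp add: nest1_grid)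
    ultimately show "x' = x \<and> y' = y" using assms by simp
  next
    assume eq: "x' = x \<and> y' = y"
    define d where "d = N + (N + 2) * y + (N - y)"
    note dd = pos[OF d_def assms(2)]
    \<comment> \<open>\<open>p\<close> and \<open>d\<close> both have positive offsets in row
      \<open>y\<close>, so anything between them has an offset \<open>t\<close> with
      \<open>0 < t < N + 2\<close> and is no row start.\<close>
    have "grid_letter N r \<noteq> 2" if "p < r \<and> r \<le> d \<or> d < r \<and> r \<le> p" for r
    proof -
      define c where "c = (N + 2) * y"
      define t where "t = r - (N + c)"
      have t: "r - N = t + c" "0 < t" "t < N + 2" "N \<le> r"
        using that assms unfolding t_def p d_def c_def[symmetric] by auto
      have "grid_offset N r = t mod (N + 2)"
        unfolding grid_offset_def t(1) c_def by (rule mod_mult_self2)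
      then have "grid_offset N r = t" using t by simp
      then show ?thesis using t by (simp add: grid_letter_def)
    qed
    moreover have "grid_letter N d = 1" using dd assms by (simp add: grid_letter_def)
    ultimately show "pairs (grid N) x' y' p"
      unfolding iff using eq pp dd assms by (auto simp: nest1_grid intro!: exI[of _ d])
  qed
qed

lemma grid_complete:
  assumes "eval h vs v"
  shows "\<forall>\<^sub>F N in sequentially. sem (grid_len N) (pairs (grid N)) h vs v"
proof (rule sem_complete[OF _ _ assms])
  show "N \<le> grid_len N" for N by (simp add: grid_len_def)
  show "\<exists>p<grid_len N. \<forall>x' y'. pairs (grid N) x' y' p \<longleftrightarrow> x' = x \<and> y' = y"
    if "x < N" "y < N" for N x y
    using pairs_grid[OF that refl] by blast
qed

section \<open>The self-referential instances\<close>

text \<open>Variable 1 takes the predecessor and variable 0 is rebound to it, so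
  \<open>Num (Suc n)\<close> is a fixed context around \<open>Num n\<close> and its code is
  primitive recursive in \<open>n\<close>.\<close>

fun Num :: "nat \<Rightarrow> mso" where
  "Num 0 = IsZero 0 1"
| "Num (Suc n) = ExFO 1 (And (IsSucc 1 0 2) (ExFO 0 (And (Eq 0 1) (Num n))))"

text \<open>A conjunct fixes variable 0 to \<open>n\<close> in place of a substitution, so the code
  is computable from \<open>n\<close> and the code of \<open>\<phi>\<close> alone.\<close>

definition inst :: "mso \<Rightarrow> nat \<Rightarrow> mso" where "inst \<phi> n = ExFO 0 (And \<phi> (Num n))"

definition Halts :: "recf \<Rightarrow> mso" where "Halts h = ExFO 1 (tr h [0] 1 2)"

lemma holds_Num: "\<forall>v. I v < length w \<Longrightarrow> holds (w, R1, R2) I J (Num n) \<longleftrightarrow> I 0 = n"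
proof (induction n arbitrary: I)
  case (Suc n)
  have "holds (w, R1, R2) I J (Num (Suc n)) \<longleftrightarrow> (\<exists>v<length w. I 0 = Suc v \<and> v = n)"
    using Suc by (simp add: cong: conj_cong)
  also have "\<dots> \<longleftrightarrow> I 0 = Suc n" using Suc.prems by (metis Suc_lessD)
  finally show ?case .
qed simp

lemma fv_Num: "fv1 (Num n) \<subseteq> {0}" "fv2 (Num n) = {}" "letters (Num n) = {}"
  by (induction n) auto

lemma fv_Halts: "fv1 (Halts h) \<subseteq> {0}" "fv2 (Halts h) = {}" "letters (Halts h) \<subseteq> {1, 2}"
  using fv_tr[of "[0]" 2 1 h] by (auto simp: Halts_def)

lemma models_inst:
  assumes "w \<noteq> []"
  shows "models (w, R1, R2) (inst (Halts h) n) \<longleftrightarrow>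
    n < length w \<and> (\<exists>v<length w. sem (length w) (pairs (w, R1, R2)) h [n] v)"
proof -
  let ?N = "(w, R1, R2)" and ?I = "\<lambda>_. 0 :: nat" and ?J = "\<lambda>_. {} :: nat set"
  have "models ?N (inst (Halts h) n) \<longleftrightarrow> (\<exists>a<length w.
      (\<exists>v<length w. holds ?N (?I(0 := a, 1 := v)) ?J (tr h [0] 1 2)) \<and> holds ?N (?I(0 := a)) ?J (Num n))"
    by (simp add: models_def inst_def Halts_def)
  also have "\<dots> \<longleftrightarrow> (\<exists>a<length w. (\<exists>v<length w. sem (length w) (pairs ?N) h [a] v) \<and> a = n)"
    using assms by (simp add: holds_tr holds_Num cong: conj_cong)
  finally show ?thesis by blast
qed

lemma models_inst_sound:
  assumes "w \<noteq> []" "models (w, R1, R2) (inst (Halts h) n)"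
  shows "\<exists>y. eval h [n] y"
proof -
  obtain v where "n < length w" "v < length w" "sem (length w) (pairs (w, R1, R2)) h [n] v"
    using assms by (auto simp: models_inst)
  then have "eval h [n] v" by (auto intro: sem_sound)
  then show ?thesis ..
qed

lemma models_inst_complete:
  assumes "eval h [n] y"
  shows "\<exists>N>0. models (grid N) (inst (Halts h) n)"
proof -
  \<comment> \<open>The number \<open>n\<close> and the result \<open>y\<close> must be positions of
    the grid, hence the lower bounds on \<open>N\<close>.\<close>
  have "\<forall>\<^sub>F N in sequentially. 0 < N \<and> models (grid N) (inst (Halts h) n)"
    using grid_complete[OF assms] eventually_gt_at_top[of 0] eventually_gt_at_top[of n]
      eventually_gt_at_top[of y]
  proof eventually_elim
    case (elim N)
    have le: "N \<le> grid_len N" by (simp add: grid_len_def)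
    then have "grid_word N \<noteq> []" using elim by (metis length_grid_word length_0_conv not_less)
    then show ?case
      using elim le unfolding grid_def nw_of_def by (auto simp: models_inst intro: less_le_trans)
  qed
  then show ?thesis using eventually_happens'[OF sequentially_bot] by blast
qed

section \<open>Computing the codes of instances\<close>

definition rAnd :: "recf \<Rightarrow> recf \<Rightarrow> recf" where
  "rAnd f g = rpair (rconst 6) (rpair (rconst 5) (rpair (rpair (rconst 6) f) (rpair (rconst 6) g)))"

definition rEx :: "nat \<Rightarrow> recf \<Rightarrow> recf" where
  "rEx x f = rpair (rconst 7) (rpair (rconst x) f)"

lemma eval_rAnd:
  "eval f xs (enc_mso p) \<Longrightarrow> eval g xs (enc_mso q) \<Longrightarrow> eval (rAnd f g) xs (enc_mso (And p q))"
  unfolding rAnd_def And_def enc_mso.simps by (intro eval_rpair eval_rconst)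

lemma eval_rEx: "eval f xs (enc_mso p) \<Longrightarrow> eval (rEx x f) xs (enc_mso (ExFO x p))"
  unfolding rEx_def enc_mso.simps by (intro eval_rpair eval_rconst)

definition rNum :: recf where
  "rNum = Pr (rconst (enc_mso (Num 0))) (rEx 1 (rAnd (rconst (enc_mso (IsSucc 1 0 2)))
     (rEx 0 (rAnd (rconst (enc_mso (Eq 0 1))) (Proj 1)))))"

lemma eval_rNum: "eval rNum [n] (enc_mso (Num n))"
  unfolding rNum_def
proof (induction n)
  case 0
  show ?case by (intro eval_Pr0 eval_rconst)
next
  case (Suc n)
  show ?case unfolding Num.simps(2)
    by (rule eval_PrS[OF Suc], intro eval_rEx eval_rAnd eval_rconst eval_Proj_eq) simp_all
qed

text \<open>The argument is used twice, as the code of a formula and as the number that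
  \<open>Num\<close> describes; this is the diagonal.\<close>

definition rinst :: recf where "rinst = rEx 0 (rAnd (Proj 0) rNum)"

lemma eval_rinst: "eval rinst [enc_mso \<phi>] (enc_mso (inst \<phi> (enc_mso \<phi>)))"
  unfolding rinst_def inst_def by (intro eval_rEx eval_rAnd eval_rNum eval_Proj_eq) simp_all

text \<open>\<open>code\<close> turns a formula code into an instance code, and \<open>g\<close> is
  the answer, with 0 meaning non-halting. Some \<open>d\<close> halts on the code of
  \<open>\<phi>\<close> iff the answer for \<open>\<phi>\<close> instantiated with its own code is
  0. For \<open>\<phi> = Halts d\<close>, it halts on that code iff it does not.\<close>

lemma no_halting_decider:
  assumes c: "\<And>e. eval c [e] (code e)"
    and f: "\<And>\<phi>. sentence \<phi> \<Longrightarrow> letters \<phi> \<subseteq> {1, 2} \<Longrightarrow> eval f [code (enc_mso \<phi>)] (g \<phi>)"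
    and g: "\<And>h n. g (inst (Halts h) n) = 0 \<longleftrightarrow> \<not> (\<exists>y. eval h [n] y)"
  shows False
proof -
  \<comment> \<open>\<open>P\<close> makes every instance of \<open>\<phi>\<close> a sentence over
    letters 1 and 2, where \<open>f\<close> is guaranteed to answer.\<close>
  define P where "P \<phi> \<longleftrightarrow> fv1 \<phi> \<subseteq> {0} \<and> fv2 \<phi> = {} \<and> letters \<phi> \<subseteq> {1, 2}" for \<phi>
  have 1: "eval (Cn c [rinst]) [enc_mso \<phi>] (code (enc_mso (inst \<phi> (enc_mso \<phi>))))" for \<phi>
    by (rule eval_Cn1[OF eval_rinst c])
  have 2: "eval f [code (enc_mso (inst \<phi> (enc_mso \<phi>)))] (g (inst \<phi> (enc_mso \<phi>)))"
    if "P \<phi>" for \<phi>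
    using that fv_Num[of "enc_mso \<phi>"]
    by (intro f) (auto simp: P_def sentence_def inst_def)
  obtain d where
    d: "\<And>\<phi>. P \<phi> \<Longrightarrow> (\<exists>y. eval d [enc_mso \<phi>] y) \<longleftrightarrow> g (inst \<phi> (enc_mso \<phi>)) = 0"
    using exists_halting_iff_zero[where enc = enc_mso and P = P and g = "\<lambda>\<phi>. g (inst \<phi> (enc_mso \<phi>))", OF 1 2]
    by blast
  have "P (Halts d)" using fv_Halts by (simp add: P_def)
  from d[OF this] show False unfolding g by blast
qed

text \<open>Every letter is combined with each of the four grid operations. Words other than grids
  are accepted as well, which is harmless because \<open>models_inst_sound\<close> covers all
  nonempty words.\<close>

definition all_cpds :: cpds where
  "all_cpds = CPDS [0] [0] [0, 1, 2]
     [(0, a, o1, 0). a \<leftarrow> [0, 1, 2], o1 \<leftarrow> [Push1 0, Push2, Pop1, Pop2]] 0 [0]"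

lemma grid_in_all_cpds: "0 < N \<Longrightarrow> grid N \<in> lang all_cpds"
proof -
  assume "0 < N"
  define ts where "ts = map (\<lambda>j. (0 :: nat, grid_letter N j, grid_op N j, 0 :: nat)) [0..<grid_len N]"
  have len: "0 < grid_len N" using \<open>0 < N\<close> by (simp add: grid_len_def)
  then have ne: "ts \<noteq> []" by (simp add: ts_def)
  have maps: "map (\<lambda>(q, a, o1, q'). a) ts = grid_word N" "map (\<lambda>(q, a, o1, q'). o1) ts = grid_ops N"
    by (auto simp: ts_def grid_word_def grid_ops_def)
  have "set ts \<subseteq> set [(0, a, o1, 0). a \<leftarrow> [0, 1, 2], o1 \<leftarrow> [Push1 0, Push2, Pop1, Pop2]]"
  proof -
    have "grid_letter N j \<in> set [0, 1, 2]" "grid_op N j \<in> set [Push1 0, Push2, Pop1, Pop2]" for j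
      by (simp_all add: grid_letter_def grid_op_def)
    moreover have "(0, a, o1, 0) \<in> set [(0 :: nat, a, o1, 0 :: nat). a \<leftarrow> [0 :: nat, 1, 2], o1 \<leftarrow> [Push1 0, Push2, Pop1, Pop2]]"
      if "a \<in> set [0, 1, 2]" "o1 \<in> set [Push1 0, Push2, Pop1, Pop2]" for a o1
      using that by auto
    ultimately show ?thesis unfolding ts_def set_map by (intro image_subsetI) blast
  qed
  moreover have "(\<lambda>(q, a, o1, q'). q) (hd ts) = 0" "(\<lambda>(q, a, o1, q'). q') (last ts) = 0"
    using len by (auto simp: ts_def hd_map last_map)
  moreover have "\<forall>k. Suc k < length ts \<longrightarrow>
      (\<lambda>(q, a, o1, q'). q) (ts ! Suc k) = (\<lambda>(q, a, o1, q'). q') (ts ! k)"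
    by (auto simp: ts_def)
  ultimately show ?thesis
    unfolding all_cpds_def lang.simps grid_def
    using ne maps valid_grid_ops[of N] by (intro CollectI exI[of _ ts]) auto
qed

lemma grid_is_2NW: "0 < N \<Longrightarrow> is_2NW [0, 1, 2] (grid N)"
  unfolding is_2NW_def grid_def
  by (intro exI[of _ "grid_word N"] exI[of _ "grid_ops N"])
     (auto simp: valid_grid_ops length_grid_ops grid_word_def grid_letter_def grid_len_def)

theorem theorem7:
  shows "\<not> decidable_on enc_sat_inst
            (\<lambda>(Alph, \<phi>). sentence \<phi> \<and> letters \<phi> \<subseteq> set Alph) MSO_SAT
       \<and> \<not> decidable_on enc_mc_inst
            (\<lambda>(\<phi>, H). sentence \<phi> \<and> wf_cpds H \<and> letters \<phi> \<subseteq> set (alphabet H)) CPDS_MC"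
proof (intro conjI notI)
  assume "decidable_on enc_sat_inst (\<lambda>(Alph, \<phi>). sentence \<phi> \<and> letters \<phi> \<subseteq> set Alph) MSO_SAT"
  then obtain f where f: "\<And>Alph \<phi>. sentence \<phi> \<Longrightarrow> letters \<phi> \<subseteq> set Alph \<Longrightarrow>
      eval f [enc_sat_inst (Alph, \<phi>)] (if MSO_SAT (Alph, \<phi>) then 1 else 0)"
    unfolding decidable_on_def by auto
  \<comment> \<open>With the alphabet of the grid words fixed, the instance code is the formula code
    paired with a constant.\<close>
  let ?A = "[0, 1, 2] :: nat list"
  show False
  proof (rule no_halting_decider)
    show "eval (rpair (rconst (list_encode ?A)) (Proj 0)) [e] (prod_encode (list_encode ?A, e))" for e
      by (intro eval_rpair eval_rconst eval_Proj_eq) simp_all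
    show "eval f [prod_encode (list_encode ?A, enc_mso \<phi>)] (if MSO_SAT (?A, \<phi>) then 1 else 0)"
      if "sentence \<phi>" "letters \<phi> \<subseteq> {1, 2}" for \<phi>
    proof -
      have "letters \<phi> \<subseteq> set ?A" using that by auto
      from f[OF that(1) this] show ?thesis unfolding enc_sat_inst_def fst_conv snd_conv .
    qed
    have "MSO_SAT (?A, inst (Halts h) n) \<longleftrightarrow> (\<exists>y. eval h [n] y)" for h n
    proof
      assume "MSO_SAT (?A, inst (Halts h) n)"
      then show "\<exists>y. eval h [n] y"
        by (auto simp: MSO_SAT_def is_2NW_def nw_of_def intro: models_inst_sound)
    next
      assume "\<exists>y. eval h [n] y"
      then show "MSO_SAT (?A, inst (Halts h) n)"
        using models_inst_complete grid_is_2NW unfolding MSO_SAT_def fst_conv snd_conv by blast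
    qed
    then show "(if MSO_SAT (?A, inst (Halts h) n) then 1 else 0 :: nat) = 0 \<longleftrightarrow>
        \<not> (\<exists>y. eval h [n] y)" for h n
      by simp
  qed
next
  assume "decidable_on enc_mc_inst
    (\<lambda>(\<phi>, H). sentence \<phi> \<and> wf_cpds H \<and> letters \<phi> \<subseteq> set (alphabet H)) CPDS_MC"
  then obtain f where f: "\<And>\<phi> H. sentence \<phi> \<Longrightarrow> wf_cpds H \<Longrightarrow> letters \<phi> \<subseteq> set (alphabet H) \<Longrightarrow>
      eval f [enc_mc_inst (\<phi>, H)] (if CPDS_MC (\<phi>, H) then 1 else 0)"
    unfolding decidable_on_def by auto
  let ?c = "enc_cpds all_cpds"
  show False
  proof (rule no_halting_decider)
    \<comment> \<open>The instance is \<open>Neg \<phi>\<close>, with code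
      \<open>prod_encode (6, e)\<close>: model checking fails iff some word of the language
      satisfies \<open>\<phi>\<close>.\<close>
    show "eval (rpair (rpair (rconst 6) (Proj 0)) (rconst ?c)) [e]
        (prod_encode (prod_encode (6, e), ?c))" for e
      by (intro eval_rpair eval_rconst eval_Proj_eq) simp_all
    have "wf_cpds all_cpds" by (simp add: all_cpds_def)
    then have "eval f [prod_encode (enc_mso (Neg \<phi>), ?c)]
        (if CPDS_MC (Neg \<phi>, all_cpds) then 1 else 0)"
      if "sentence \<phi>" "letters \<phi> \<subseteq> {1, 2}" for \<phi>
    proof -
      have "sentence (Neg \<phi>)" "letters (Neg \<phi>) \<subseteq> set (alphabet all_cpds)"
        using that by (auto simp: sentence_def all_cpds_def)
      from f[OF this(1) \<open>wf_cpds all_cpds\<close> this(2)]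
      show ?thesis unfolding enc_mc_inst_def fst_conv snd_conv .
    qed
    \<comment> \<open>Checking the negation succeeds exactly when \<open>h\<close> does not halt;
      \<open>risz\<close> flips the answer so that this case yields 0.\<close>
    then show "eval (Cn risz [f]) [prod_encode (prod_encode (6, enc_mso \<phi>), ?c)]
        (if (if CPDS_MC (Neg \<phi>, all_cpds) then 1 else 0 :: nat) = 0 then 1 else 0)"
      if "sentence \<phi>" "letters \<phi> \<subseteq> {1, 2}" for \<phi>
      using that unfolding enc_mso.simps by (intro eval_Cn1[OF _ eval_risz])
    have "CPDS_MC (Neg (inst (Halts h) n), all_cpds) \<longleftrightarrow> \<not> (\<exists>y. eval h [n] y)" for h n
    proof -
      have "\<exists>y. eval h [n] y" if "N \<in> lang all_cpds" "models N (inst (Halts h) n)" for N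
        using that by (auto simp: all_cpds_def nw_of_def intro: models_inst_sound[rotated])
      moreover have "\<exists>N\<in>lang all_cpds. models N (inst (Halts h) n)" if "\<exists>y. eval h [n] y"
        using that models_inst_complete grid_in_all_cpds by blast
      ultimately show ?thesis
        unfolding CPDS_MC_def fst_conv snd_conv models_def holds_Or_Neg by blast
    qed
    then show "(if (if CPDS_MC (Neg (inst (Halts h) n), all_cpds) then 1 else 0 :: nat) = 0
        then 1 else 0 :: nat) = 0 \<longleftrightarrow> \<not> (\<exists>y. eval h [n] y)" for h n
      by simp
  qed
qed

end
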